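(* Let $V=\{1,\dots,n\}$, $m\ge1$, and let $f_1,\dots,f_m:2^V\to\mathbb{R}$ be normalized, monotone non-decreasing, submodular functions. Let $\epsilon>0$ and $0\le\alpha\le1$, and let $\hat\pi$ be the output of the algorithm GreedSat (described in the context) with these inputs, using a subroutine that is an $\alpha$-approximation for maximizing $\bar F^c$. Then for any $0<\delta<\alpha$, at least $\lceil m(\alpha-\delta)\rceil$ indices $i\in\{1,\dots,m\}$ satisfy $$f_i(A_i^{\hat\pi}) \ \ge\ \frac{\delta}{1-\alpha+\delta}\Big(\max_{\pi\in\Pi}\min_{i'} f_{i'}(A_{i'}^{\pi})-\epsilon\Big).$$
   Context: $f$ is normalized if $f(\emptyset)=0$, monotone non-decreasing if $f(S)\le f(T)$ for $S\subseteq T$, submodular if $f(S)+f(T)\ge f(S\cup T)+f(S\cap T)$ for all $S,T$. $\Pi$ is the set of ordered partitions $\pi=(A_1^\pi,\dots,A_m^\pi)$ of $V$ into $m$ pairwise disjoint (possibly empty) blocks covering $V$. For $c\ge0$ define $\bar F^c(\pi)=\frac1m\sum_{i=1}^m\min\{f_i(A_i^\pi),c\}$. The subroutine, given $c$, returns a partition $\hat\pi^c$ with $\bar F^c(\hat\pi^c)\ge \alpha\max_{\pi\in\Pi}\bar F^c(\pi)$. GreedSat: set $c_{\min}=0$, $c_{\max}=\min_i f_i(V)$; while $c_{\max}-c_{\min}\ge\epsilon$: let $c=\frac12(c_{\max}+c_{\min})$, compute $\hat\pi^c$ by the subroutine; if $\bar F^c(\hat\pi^c)<\alpha c$ set $c_{\max}=c$,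 otherwise set $c_{\min}=c$ and $\hat\pi\leftarrow\hat\pi^c$. Output $\hat\pi$. *)

theory Defs
  imports Complex_Main "HOL-Library.FuncSet" "HOL-Library.Disjoint_Sets"
    "HOL-Library.While_Combinator"
begin

definition normalized :: "('a set \<Rightarrow> real) \<Rightarrow> bool" where
  "normalized f \<longleftrightarrow> f {} = 0"

definition submodular_on :: "'a set \<Rightarrow> ('a set \<Rightarrow> real) \<Rightarrow> bool" where
  "submodular_on V f \<longleftrightarrow>
     (\<forall>S T. S \<subseteq> V \<longrightarrow> T \<subseteq> V \<longrightarrow> f S + f T \<ge> f (S \<union> T) + f (S \<inter> T))"

text \<open>The block families are extensional (undefined outside the index set), so that for finite
  \<^term>\<open>V\<close> the set of ordered partitions is finite and \<^const>\<open>Max\<close> over it is a genuine maximum.\<close>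

definition ordered_partitions :: "'a set \<Rightarrow> nat \<Rightarrow> (nat \<Rightarrow> 'a set) set" where
  "ordered_partitions V m =
     {A \<in> {1..m} \<rightarrow>\<^sub>E Pow V. disjoint_family_on A {1..m} \<and> (\<Union>i\<in>{1..m}. A i) = V}"

definition Fbar :: "nat \<Rightarrow> (nat \<Rightarrow> 'a set \<Rightarrow> real) \<Rightarrow> real \<Rightarrow> (nat \<Rightarrow> 'a set) \<Rightarrow> real" where
  "Fbar m f c A = (1 / real m) * (\<Sum>i=1..m. min (f i (A i)) c)"

definition approx_subroutine ::
  "'a set \<Rightarrow> nat \<Rightarrow> (nat \<Rightarrow> 'a set \<Rightarrow> real) \<Rightarrow> real \<Rightarrow> (real \<Rightarrow> nat \<Rightarrow> 'a set) \<Rightarrow> bool" where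
  "approx_subroutine V m f \<alpha> sub \<longleftrightarrow>
     (\<forall>c\<ge>0. sub c \<in> ordered_partitions V m \<and>
        Fbar m f c (sub c) \<ge> \<alpha> * (MAX A\<in>ordered_partitions V m. Fbar m f c A))"

text \<open>The loop state is \<^term>\<open>(cmin, cmax, A)\<close> with \<^term>\<open>A\<close> the current candidate partition.
  The argument \<^term>\<open>A0\<close> is the value of the candidate before its first assignment; it is the
  output if no tested threshold is ever accepted.\<close>

definition greedsat ::
  "'a set \<Rightarrow> nat \<Rightarrow> (nat \<Rightarrow> 'a set \<Rightarrow> real) \<Rightarrow> real \<Rightarrow> real \<Rightarrow> (real \<Rightarrow> nat \<Rightarrow> 'a set)
    \<Rightarrow> (nat \<Rightarrow> 'a set) \<Rightarrow> (nat \<Rightarrow> 'a set)" where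
  "greedsat V m f \<epsilon> \<alpha> sub A0 =
     snd (snd (while
       (\<lambda>(cmin, cmax, A). cmax - cmin \<ge> \<epsilon>)
       (\<lambda>(cmin, cmax, A).
          let c = (cmax + cmin) / 2
          in if Fbar m f c (sub c) < \<alpha> * c then (cmin, c, A) else (c, cmax, sub c))
       (0, (MIN i\<in>{1..m}. f i V), A0)))"

end

theory Submission
  imports Defs
begin

text \<open>
  GreedSat maintains the invariant that the optimum is at most \<open>cmax\<close> and that the candidate has
  average saturated value at least \<open>\<alpha> * cmin\<close>: if the optimum were at least \<open>c\<close>, an optimal
  partition would have saturated average exactly \<open>c\<close>, so the subroutine could not return
  less than \<open>\<alpha> * c\<close>. On termination \<open>cmin\<close> exceeds the optimum minus \<open>\<epsilon>\<close>, and a Markov-type count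
  converts the average of values capped at \<open>cmin\<close> into a number of large values.
\<close>

lemma finite_ordered_partitions:
  assumes "finite V"
  shows "finite (ordered_partitions V m)"
  unfolding ordered_partitions_def
  by (rule finite_subset[OF _ finite_PiE[of "{1..m}" "\<lambda>_. Pow V"]]) (use assms in auto)

lemma ordered_partitions_block_subset:
  assumes "A \<in> ordered_partitions V m" "i \<in> {1..m}"
  shows "A i \<subseteq> V"
  using assms by (auto simp: ordered_partitions_def)

text \<open>Members of \<open>K\<close> contribute at most \<open>c\<close> to the capped sum and
  all others less than \<open>\<beta> * c\<close>. The constant \<open>\<beta>\<close> solves
  \<open>(\<alpha> - \<delta>) + (1 - \<alpha> + \<delta>) * \<beta> = \<alpha>\<close>: it is the
  level of the remaining values when a fraction \<open>\<alpha> - \<delta>\<close> sits at the cap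
  and the mean is \<open>\<alpha> * c\<close>.\<close>

lemma card_ge_of_capped_mean_ge:
  fixes x :: "'i \<Rightarrow> real"
  assumes "finite I" and "0 < c" and "\<alpha> \<le> 1" and "0 < \<delta>" and "\<delta> < \<alpha>"
    and mean: "real (card I) * (\<alpha> * c) \<le> (\<Sum>i\<in>I. min (x i) c)"
  shows "real (card I) * (\<alpha> - \<delta>) \<le> real (card {i \<in> I. \<delta> / (1 - \<alpha> + \<delta>) * c \<le> x i})"
proof -
  define D where "D = 1 - \<alpha> + \<delta>"
  define \<beta> where "\<beta> = \<delta> / D"
  define K where "K = {i \<in> I. \<beta> * c \<le> x i}"
  have D: "D > 0" and \<beta>D: "\<beta> * D = \<delta>"
    using assms by (auto simp: D_def \<beta>_def)
  have fin: "finite K" "finite (I - K)" and KI: "K \<subseteq> I"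
    using assms(1) by (auto simp: K_def)
  have cardI: "card I = card K + card (I - K)"
    using card_Diff_subset[OF fin(1) KI] card_mono[OF assms(1) KI] by linarith
  show ?thesis
  \<comment> \<open>The strict bound on the sum over \<open>I - K\<close> needs a nonempty index
    set.\<close>
  proof (cases "I - K = {}")
    case True
    hence "K = I" using KI by auto
    moreover have "real (card I) * (\<alpha> - \<delta>) \<le> real (card I) * 1"
      using assms by (intro mult_left_mono) auto
    ultimately show ?thesis by (simp add: K_def \<beta>_def D_def)
  next
    case False
    have "(\<Sum>i\<in>I. min (x i) c) = (\<Sum>i\<in>K. min (x i) c) + (\<Sum>i\<in>I - K. min (x i) c)"
      using sum.subset_diff[OF KI assms(1), of "\<lambda>i. min (x i) c"] by simp
    also have "(\<Sum>i\<in>K. min (x i) c) \<le> (\<Sum>i\<in>K. c)"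
      by (intro sum_mono) auto
    also have "(\<Sum>i\<in>I - K. min (x i) c) < (\<Sum>i\<in>I - K. \<beta> * c)"
      using fin(2) False by (intro sum_strict_mono) (auto simp: K_def)
    finally have "real (card I) * (\<alpha> * c) < real (card K) * c + real (card (I - K)) * (\<beta> * c)"
      using mean by simp
    hence "(real (card I) * \<alpha>) * c < (real (card K) + real (card (I - K)) * \<beta>) * c"
      by (simp add: algebra_simps)
    hence "real (card I) * \<alpha> < real (card K) + real (card (I - K)) * \<beta>"
      using assms(2) by simp
    hence "(real (card I) * \<alpha>) * D < (real (card K) + real (card (I - K)) * \<beta>) * D"
      using D by simp
    also have "\<dots> = real (card K) * D + (real (card I) - real (card K)) * \<delta>"
      using \<beta>D cardI by (simp add: distrib_right mult.assoc)
    \<comment> \<open>Collecting terms uses \<open>\<alpha> * D - \<delta> = (1 - \<alpha>) *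
      (\<alpha> - \<delta>)\<close> and \<open>D - \<delta> = 1 - \<alpha>\<close>.\<close>
    finally have "(1 - \<alpha>) * (real (card I) * (\<alpha> - \<delta>)) < (1 - \<alpha>) * real (card K)"
      by (simp add: D_def algebra_simps)
    \<comment> \<open>Strictness excludes \<open>\<alpha> = 1\<close>, which would give
      \<open>0 < 0\<close>, so the factor is positive and cancels.\<close>
    hence "real (card I) * (\<alpha> - \<delta>) < real (card K)"
      using assms(3) by (simp add: mult_less_cancel_left)
    thus ?thesis by (simp add: K_def \<beta>_def D_def)
  qed
qed

text \<open>Capping makes every block of \<open>B\<close> worth exactly \<open>c\<close>, so the
  maximum of \<open>Fbar\<close> is at least \<open>c\<close>. Used in contraposition: a rejected
  \<open>c\<close> is an upper bound for the optimum.\<close>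

lemma approx_subroutine_accepts:
  assumes "1 \<le> m" and "finite V" and "0 \<le> \<alpha>" and "0 \<le> c"
    and sub: "approx_subroutine V m f \<alpha> sub"
    and B: "B \<in> ordered_partitions V m" "\<And>i. i \<in> {1..m} \<Longrightarrow> c \<le> f i (B i)"
  shows "\<alpha> * c \<le> Fbar m f c (sub c)"
proof -
  have "(\<Sum>i=1..m. min (f i (B i)) c) = (\<Sum>i=1..m. c)"
    using B(2) by (intro sum.cong) (auto simp: min_def intro: antisym)
  hence "Fbar m f c B = c"
    using assms(1) by (simp add: Fbar_def)
  hence "c \<le> (MAX A\<in>ordered_partitions V m. Fbar m f c A)"
    using B(1) finite_ordered_partitions[OF assms(2)] by (metis Max_ge finite_imageI imageI)
  hence "\<alpha> * c \<le> \<alpha> * (MAX A\<in>ordered_partitions V m. Fbar m f c A)"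
    using assms(3) by (rule mult_left_mono)
  also have "\<dots> \<le> Fbar m f c (sub c)"
    using sub assms(4) by (simp add: approx_subroutine_def)
  finally show ?thesis .
qed

text \<open>The witness \<open>c\<close> is the final \<open>cmin\<close>, which
  \<open>greedsat\<close> discards by projecting to the partition. If no threshold is ever accepted,
  it is \<open>0\<close> and the output is \<open>A0\<close>.\<close>

lemma greedsat_threshold:
  fixes f :: "nat \<Rightarrow> 'a set \<Rightarrow> real" and V :: "'a set" and m :: nat
  defines "opt \<equiv> MAX A\<in>ordered_partitions V m. MIN i\<in>{1..m}. f i (A i)"
  assumes m: "1 \<le> m" and V: "finite V"
    and norm: "\<And>i. i \<in> {1..m} \<Longrightarrow> normalized (f i)"
    and mono: "\<And>i. i \<in> {1..m} \<Longrightarrow> mono_on (Pow V) (f i)"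
    and \<epsilon>: "0 < \<epsilon>" and \<alpha>: "0 \<le> \<alpha>"
    and sub: "approx_subroutine V m f \<alpha> sub"
    and A0: "A0 \<in> ordered_partitions V m"
  obtains c where "0 \<le> c" "opt - \<epsilon> < c"
    "greedsat V m f \<epsilon> \<alpha> sub A0 \<in> ordered_partitions V m"
    "\<alpha> * c \<le> Fbar m f c (greedsat V m f \<epsilon> \<alpha> sub A0)"
proof -
  let ?P = "ordered_partitions V m"
  let ?val = "\<lambda>A. MIN i\<in>{1..m}. f i (A i)"
  define b where "b = (\<lambda>(cmin, cmax, A :: nat \<Rightarrow> 'a set). cmax - cmin \<ge> \<epsilon>)"
  define step where "step = (\<lambda>(cmin, cmax, A).
          let c = (cmax + cmin) / 2
          in if Fbar m f c (sub c) < \<alpha> * c then (cmin, c, A) else (c, cmax, sub c))"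
  define s0 where "s0 = (0 :: real, (MIN i\<in>{1..m}. f i V), A0)"
  define Inv where "Inv = (\<lambda>(cmin, cmax, A). 0 \<le> cmin \<and> opt \<le> cmax \<and> A \<in> ?P
      \<and> \<alpha> * cmin \<le> Fbar m f cmin A)"
  \<comment> \<open>Counts the halvings left until the interval is shorter than
    \<open>\<epsilon>\<close>. The \<open>+ 1\<close> keeps the rank positive for a length of
    exactly \<open>\<epsilon>\<close>, where the loop still runs.\<close>
  define rank where "rank = (\<lambda>(cmin, cmax, A :: nat \<Rightarrow> 'a set).
      nat \<lfloor>log 2 ((cmax - cmin) / \<epsilon>) + 1\<rfloor>)"
  have finP: "finite (?val ` ?P)" and neP: "?val ` ?P \<noteq> {}"
    using finite_ordered_partitions[OF V] A0 by auto
  have ne: "{1..m} \<noteq> {}" using m by auto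
  obtain B where B: "B \<in> ?P" "opt = ?val B"
    using Max_in[OF finP neP] unfolding opt_def by blast
  have opt_le: "opt \<le> f i (B i)" if "i \<in> {1..m}" for i
    unfolding B(2) using that by (intro Min_le) auto
  have nonneg: "0 \<le> f i (A i)" if "A \<in> ?P" "i \<in> {1..m}" for A i
    using mono_onD[OF mono[OF that(2)], of "{}" "A i"] norm[OF that(2)]
      ordered_partitions_block_subset[OF that] by (simp add: normalized_def)
  have init: "Inv s0"
  proof -
    \<comment> \<open>By monotonicity, no block of the optimal partition \<open>B\<close> is worth
      more than all of \<open>V\<close>.\<close>
    have "opt \<le> f i V" if "i \<in> {1..m}" for i
      using opt_le[OF that] mono_onD[OF mono[OF that], of "B i" V]
        ordered_partitions_block_subset[OF B(1) that] by simp
    hence "opt \<le> (MIN i\<in>{1..m}. f i V)"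
      using ne by (intro Min.boundedI) auto
    moreover have "0 \<le> Fbar m f 0 A0"
      unfolding Fbar_def using nonneg[OF A0]
      by (intro mult_nonneg_nonneg sum_nonneg) auto
    ultimately show ?thesis using A0 by (simp add: Inv_def s0_def)
  qed
  have pres: "Inv (step s)" if "Inv s" "b s" for s
  proof -
    obtain cmin cmax A where s: "s = (cmin, cmax, A)" by (cases s)
    define c where "c = (cmax + cmin) / 2"
    have c: "0 \<le> c" using that \<epsilon> by (auto simp: s Inv_def b_def c_def)
    show ?thesis
    proof (cases "Fbar m f c (sub c) < \<alpha> * c")
      case True
      have "opt \<le> c"
      proof (rule ccontr)
        assume "\<not> opt \<le> c"
        hence "c \<le> f i (B i)" if "i \<in> {1..m}" for i using opt_le[OF that] by linarith
        from approx_subroutine_accepts[OF m V \<alpha> c sub B(1) this] True show False by simp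
      qed
      with True that show ?thesis by (simp add: s Inv_def step_def Let_def c_def)
    next
      case False
      moreover have "sub c \<in> ?P" using sub c by (simp add: approx_subroutine_def)
      ultimately show ?thesis using that c by (simp add: s Inv_def step_def Let_def c_def)
    qed
  qed
  have decr: "rank (step s) < rank s" if "b s" for s
  proof -
    obtain cmin cmax A where s: "s = (cmin, cmax, A)" by (cases s)
    define w where "w = (cmax - cmin) / \<epsilon>"
    have w: "1 \<le> w" using that \<epsilon> by (simp add: s b_def w_def)
    \<comment> \<open>Both branches replace one endpoint by the midpoint, hence halve the
      length.\<close>
    have "rank (step s) = nat \<lfloor>log 2 (w / 2) + 1\<rfloor>"
      by (auto simp: s step_def rank_def Let_def w_def field_simps
          intro!: arg_cong[of _ _ "\<lambda>x. nat \<lfloor>log 2 x + 1\<rfloor>"] arg_cong[of _ _ "\<lambda>x. nat \<lfloor>log 2 x\<rfloor>"])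
    also have "log 2 (w / 2) = log 2 w - 1"
      using w by (simp add: log_divide)
    finally have "rank (step s) = nat \<lfloor>log 2 w\<rfloor>" by simp
    moreover have "rank s = nat (\<lfloor>log 2 w\<rfloor> + 1)" by (simp add: s rank_def w_def)
    \<comment> \<open>Rules out truncation by \<open>nat\<close>, so the decrease is strict.\<close>
    moreover have "0 \<le> \<lfloor>log 2 w\<rfloor>" using w by simp
    ultimately show ?thesis by simp
  qed
  have "Inv (while b step s0) \<and> \<not> b (while b step s0)"
    by (rule while_rule[where P = Inv and r = "measure rank"])
      (use init pres decr in auto)
  moreover obtain cmin cmax A where fin: "while b step s0 = (cmin, cmax, A)"
    by (cases "while b step s0")
  moreover have "greedsat V m f \<epsilon> \<alpha> sub A0 = A"
    using fin by (simp add: greedsat_def b_def step_def s0_def)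
  ultimately show ?thesis
    by (intro that[of cmin]) (auto simp: Inv_def b_def)
qed

theorem theorem3:
  fixes n m :: nat
    and f :: "nat \<Rightarrow> nat set \<Rightarrow> real"
    and \<epsilon> \<alpha> \<delta> :: real
    and sub :: "real \<Rightarrow> nat \<Rightarrow> nat set"
    and A0 :: "nat \<Rightarrow> nat set"
  assumes "m \<ge> 1"
    and "\<And>i. i \<in> {1..m} \<Longrightarrow> normalized (f i)"
    and "\<And>i. i \<in> {1..m} \<Longrightarrow> mono_on (Pow {1..n}) (f i)"
    and "\<And>i. i \<in> {1..m} \<Longrightarrow> submodular_on {1..n} (f i)"
    and "\<epsilon> > 0"
    and "0 \<le> \<alpha>" and "\<alpha> \<le> 1"
    and "approx_subroutine {1..n} m f \<alpha> sub"
    and "A0 \<in> ordered_partitions {1..n} m"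
    and "0 < \<delta>" and "\<delta> < \<alpha>"
  shows "int (card {i \<in> {1..m}.
            f i (greedsat {1..n} m f \<epsilon> \<alpha> sub A0 i)
              \<ge> \<delta> / (1 - \<alpha> + \<delta>)
                 * ((MAX A\<in>ordered_partitions {1..n} m. MIN i'\<in>{1..m}. f i' (A i')) - \<epsilon>)})
         \<ge> \<lceil>real m * (\<alpha> - \<delta>)\<rceil>"
proof -
  let ?A = "greedsat {1..n} m f \<epsilon> \<alpha> sub A0"
  let ?opt = "MAX A\<in>ordered_partitions {1..n} m. MIN i'\<in>{1..m}. f i' (A i')"
  let ?\<beta> = "\<delta> / (1 - \<alpha> + \<delta>)"
  let ?G = "{i \<in> {1..m}. ?\<beta> * (?opt - \<epsilon>) \<le> f i (?A i)}"
  obtain c where c: "0 \<le> c" "?opt - \<epsilon> < c" and A: "?A \<in> ordered_partitions {1..n} m"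
    and mean: "\<alpha> * c \<le> Fbar m f c ?A"
    using greedsat_threshold[OF assms(1) finite_atLeastAtMost assms(2,3,5,6,8,9)] by blast
  have \<beta>: "0 \<le> ?\<beta>" using assms by simp
  have le: "?\<beta> * (?opt - \<epsilon>) \<le> ?\<beta> * c"
    using c(2) \<beta> by (intro mult_left_mono) auto
  have "real m * (\<alpha> - \<delta>) \<le> real (card ?G)"
  \<comment> \<open>The counting lemma divides by the cap. For \<open>c = 0\<close> the target value
    is nonpositive and every index qualifies, since normalized monotone functions are
    nonnegative.\<close>
  proof (cases "c = 0")
    case True
    have "0 \<le> f i (?A i)" if "i \<in> {1..m}" for i
      using mono_onD[OF assms(3)[OF that], of "{}" "?A i"] assms(2)[OF that]
        ordered_partitions_block_subset[OF A that] by (simp add: normalized_def)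
    moreover have "?\<beta> * (?opt - \<epsilon>) \<le> 0" using le True by simp
    ultimately have "?G = {1..m}" by fastforce
    moreover have "real m * (\<alpha> - \<delta>) \<le> real m * 1"
      using assms by (intro mult_left_mono) auto
    ultimately show ?thesis by simp
  next
    case False
    hence "0 < c" using c(1) by simp
    moreover have "real (card {1..m}) * (\<alpha> * c) \<le> (\<Sum>i=1..m. min (f i (?A i)) c)"
      using mean assms(1) by (simp add: Fbar_def field_simps)
    ultimately have "real (card {1..m}) * (\<alpha> - \<delta>) \<le> real (card {i \<in> {1..m}. ?\<beta> * c \<le> f i (?A i)})"
      using assms by (intro card_ge_of_capped_mean_ge) auto
    \<comment> \<open>Since \<open>?opt - \<epsilon> < c\<close>, passing from \<open>c\<close> to
      \<open>?opt - \<epsilon>\<close> does not raise the required value, so no index is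
      lost.\<close>
    also have "\<dots> \<le> real (card ?G)"
      using le by (intro of_nat_mono card_mono) (auto intro: order_trans)
    finally show ?thesis by simp
  qed
  thus ?thesis by (simp add: ceiling_le_iff)
qed

end
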